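(* Let $X$ be a Banach function space over the unit circle $\mathbb{T}$. If the Hilbert transform $\mathcal{C}$ is of weak type $(L^\infty,X)$, then $X_a=X_b$.
   Context: $\mathbb{T}$ is the unit circle in $\mathbb{C}$ with normalized Lebesgue measure $dm(t)=|dt|/(2\pi)$; $L^p=L^p(\mathbb{T})$ with respect to $m$; $L^0$ is the space of measurable complex-valued functions on $\mathbb{T}$, and $L^0_+$ is the set of measurable functions on $\mathbb{T}$ with values in $[0,\infty]$. $\mathbb{I}_E$ is the indicator function of $E$. A Banach function norm is a mapping $\rho:L^0_+\to[0,\infty]$ such that for all $f,g,f_n\in L^0_+$ ($n\in\mathbb{N}$), all constants $c\ge 0$ and all measurable $E\subset\mathbb{T}$: (A1) $\rho(f)=0\Leftrightarrow f=0$ a.e., $\rho(cf)=c\rho(f)$, $\rho(f+g)\le\rho(f)+\rho(g)$; (A2) $0\le g\le f$ a.e. implies $\rho(g)\le\rho(f)$; (A3) $0\le f_n\uparrow f$ a.e. implies $\rho(f_n)\uparrow\rho(f)$; (A4) $\rho(\mathbb{I}_E)<\infty$; (A5) $\int_E f\,dm\le C_E\,\rho(f)$ with a constant $C_E\in(0,\infty)$ independent of $f$. The Banach function space determined by $\rho$ is $X=\{f\in L^0:\rho(|f|)<\infty\}$ (functions equal a.e. are identified) with norm $\|f\|_X=\rho(|f|)$. $X_a$ is the set of all $f\in X$ with absolutely continuous norm, i.e. such that $\|f\mathbb{I}_{\gamma_n}\|_X\to0$ for every sequence $\{\gamma_n\}_{n\in\mathbb{N}}$ of measurable subsets of $\mathbb{T}$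 with $\mathbb{I}_{\gamma_n}\to0$ a.e.; $X_b$ is the closure in $X$ of the set of simple functions on $\mathbb{T}$. The Hilbert transform is defined for $f\in L^1$ by $(\mathcal{C}f)(e^{i\vartheta})=\frac1{2\pi}\,\mathrm{p.v.}\int_{-\pi}^{\pi}f(e^{i\theta})\cot\frac{\vartheta-\theta}2\,d\theta$ (for a.e. $\vartheta\in[-\pi,\pi]$). $\mathcal{C}$ is of weak type $(L^\infty,X)$ if there is a constant $C>0$ such that $\big\|\mathbb{I}_{\{\zeta\in\mathbb{T}:|(\mathcal{C}f)(\zeta)|>\lambda\}}\big\|_X\le C\|f\|_{L^\infty}/\lambda$ for all $\lambda>0$ and all $f\in L^\infty$. *)

theory Defs
  imports "HOL-Probability.Probability"
begin

text \<open>
  Normalized Lebesgue measure on the unit circle. The completion makes the measurable sets the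
  Lebesgue measurable (and not just the Borel) ones. The space is the circle itself, so the
  values of functions \<^typ>\<open>complex \<Rightarrow> 'a\<close> off the circle are irrelevant below.
\<close>

definition circle :: "complex measure" where
  "circle = completion
     (distr (uniform_measure lborel {-pi..pi}) (restrict_space borel (sphere 0 1)) cis)"

lemma space_circle [simp]: "space circle = sphere 0 1"
  by (simp add: circle_def space_restrict_space)

lemma prob_space_circle: "prob_space circle"
proof -
  have "cis \<in> borel_measurable borel"
    by (intro borel_measurable_continuous_onI continuous_intros)
  then have cis: "cis \<in> uniform_measure lborel {-pi..pi} \<rightarrow>\<^sub>M restrict_space borel (sphere 0 1)"
    by (intro measurable_restrict_space2) auto
  have "prob_space (uniform_measure lborel {-pi..pi})"
    by (intro prob_space_uniform_measure) auto
  then have "prob_space (distr (uniform_measure lborel {-pi..pi}) (restrict_space borel (sphere 0 1)) cis)"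
    using cis by (rule prob_space.prob_space_distr)
  then show ?thesis
    unfolding circle_def by (rule prob_space.prob_space_completion)
qed

text \<open>
  A function norm is a total function on \<^typ>\<open>complex \<Rightarrow> ennreal\<close>, but it is constrained only on
  measurable functions; by (A1) and (A2) its values there do not change when the argument is
  modified on a null set or off the circle.
\<close>

definition banach_function_norm :: "((complex \<Rightarrow> ennreal) \<Rightarrow> ennreal) \<Rightarrow> bool" where
  "banach_function_norm \<rho> \<longleftrightarrow>
     \<comment> \<open>(A1)\<close>
     (\<forall>f\<in>borel_measurable circle. \<rho> f = 0 \<longleftrightarrow> (AE z in circle. f z = 0)) \<and>
     (\<forall>f\<in>borel_measurable circle. \<forall>c::real. 0 \<le> c \<longrightarrow> \<rho> (\<lambda>z. ennreal c * f z) = ennreal c * \<rho> f) \<and>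
     (\<forall>f\<in>borel_measurable circle. \<forall>g\<in>borel_measurable circle. \<rho> (\<lambda>z. f z + g z) \<le> \<rho> f + \<rho> g) \<and>
     \<comment> \<open>(A2)\<close>
     (\<forall>f\<in>borel_measurable circle. \<forall>g\<in>borel_measurable circle.
        (AE z in circle. g z \<le> f z) \<longrightarrow> \<rho> g \<le> \<rho> f) \<and>
     \<comment> \<open>(A3)\<close>
     (\<forall>F f. (\<forall>n::nat. F n \<in> borel_measurable circle) \<and> f \<in> borel_measurable circle \<and>
        (AE z in circle. incseq (\<lambda>n. F n z) \<and> (\<lambda>n. F n z) \<longlonglongrightarrow> f z) \<longrightarrow>
        incseq (\<lambda>n. \<rho> (F n)) \<and> (\<lambda>n. \<rho> (F n)) \<longlonglongrightarrow> \<rho> f) \<and>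
     \<comment> \<open>(A4)\<close>
     (\<forall>E\<in>sets circle. \<rho> (indicator E) < \<infinity>) \<and>
     \<comment> \<open>(A5)\<close>
     (\<forall>E\<in>sets circle. \<exists>C::real. 0 < C \<and>
        (\<forall>f\<in>borel_measurable circle. (\<integral>\<^sup>+z\<in>E. f z \<partial>circle) \<le> ennreal C * \<rho> f))"

definition X_norm :: "((complex \<Rightarrow> ennreal) \<Rightarrow> ennreal) \<Rightarrow> (complex \<Rightarrow> complex) \<Rightarrow> ennreal" where
  "X_norm \<rho> f = \<rho> (\<lambda>z. ennreal (cmod (f z)))"

text \<open>
  The spaces are sets of functions rather than of classes modulo a.e. equality; each of them
  contains, with a function, every measurable function that agrees with it almost everywhere.
\<close>

definition X_space :: "((complex \<Rightarrow> ennreal) \<Rightarrow> ennreal) \<Rightarrow> (complex \<Rightarrow> complex) set" where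
  "X_space \<rho> = {f \<in> borel_measurable circle. X_norm \<rho> f < \<infinity>}"

definition X_a :: "((complex \<Rightarrow> ennreal) \<Rightarrow> ennreal) \<Rightarrow> (complex \<Rightarrow> complex) set" where
  "X_a \<rho> = {f \<in> X_space \<rho>. \<forall>\<gamma>. (\<forall>n::nat. \<gamma> n \<in> sets circle) \<and>
     (AE z in circle. (\<lambda>n. indicator (\<gamma> n) z :: real) \<longlonglongrightarrow> 0) \<longrightarrow>
     (\<lambda>n. X_norm \<rho> (\<lambda>z. f z * indicator (\<gamma> n) z)) \<longlonglongrightarrow> 0}"

definition X_b :: "((complex \<Rightarrow> ennreal) \<Rightarrow> ennreal) \<Rightarrow> (complex \<Rightarrow> complex) set" where
  "X_b \<rho> = {f \<in> X_space \<rho>. \<forall>\<epsilon>>0. \<exists>s. simple_function circle s \<and> X_norm \<rho> (\<lambda>z. f z - s z) < \<epsilon>}"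

definition Linf_norm :: "(complex \<Rightarrow> complex) \<Rightarrow> ennreal" where
  "Linf_norm f = esssup circle (\<lambda>z. ennreal (cmod (f z)))"

definition Linf :: "(complex \<Rightarrow> complex) set" where
  "Linf = {f \<in> borel_measurable circle. Linf_norm f < \<infinity>}"

text \<open>
  The principal value is the limit of the integrals over \<open>\<epsilon> \<le> \<bar>\<theta> - Arg \<zeta>\<bar>\<close>. It exists for almost
  every \<open>\<zeta>\<close> if \<open>f\<close> is integrable; on the exceptional null set the value is a junk value.
  The cut at \<open>\<plusminus>\<pi>\<close> matters only for the single point \<open>\<zeta> = -1\<close>.
\<close>

definition hilbert_transform :: "(complex \<Rightarrow> complex) \<Rightarrow> complex \<Rightarrow> complex" where
  "hilbert_transform f \<zeta> = 1 / (2 * complex_of_real pi) *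
     Lim (at_right 0) (\<lambda>\<epsilon>. LINT \<theta>:{\<theta> \<in> {-pi..pi}. \<epsilon> \<le> \<bar>\<theta> - Arg \<zeta>\<bar>}|lebesgue.
       f (cis \<theta>) * complex_of_real (cot ((Arg \<zeta> - \<theta>) / 2)))"

definition hilbert_weak_type_Linf :: "((complex \<Rightarrow> ennreal) \<Rightarrow> ennreal) \<Rightarrow> bool" where
  "hilbert_weak_type_Linf \<rho> \<longleftrightarrow>
     (\<exists>C::real. 0 < C \<and> (\<forall>l::real. 0 < l \<longrightarrow> (\<forall>f\<in>Linf.
        X_norm \<rho> (indicator {\<zeta> \<in> sphere 0 1. l < cmod (hilbert_transform f \<zeta>)})
          \<le> ennreal C * Linf_norm f / ennreal l)))"

end

theory Submission
  imports Defs "HOL-Complex_Analysis.Conformal_Mappings"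
begin

text \<open>
  The weak type hypothesis forces \<open>\<rho> (indicator E)\<close> to tend to \<open>0\<close> with the measure of \<open>E\<close>. By
  inner regularity and (A3) it suffices to take \<open>E = K\<close> compact, of measure less than \<open>\<delta>\<close>. By the
  Weierstrass theorem there is a polynomial \<open>p\<close> with \<open>Re p > 0\<close> on the circle, \<open>Re p \<ge> 1\<close> on \<open>K\<close>
  and \<open>0 \<le> p 0 < \<delta>\<close>. Then \<open>H = Ln (1 + p / \<delta>)\<close> is holomorphic near the closed disc, so
  \<open>Im H\<close> is bounded by \<open>\<pi>\<close>, while its Hilbert transform \<open>Re (H 0) - Re H\<close> has modulus at least
  \<open>ln (1 + 1 / \<delta>) - ln 2\<close> on \<open>K\<close>.

  Consequently bounded functions, hence their limits, have absolutely continuous norm. Conversely, for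
  simple functions \<open>F n\<close> that tend to \<open>f \<in> X_a\<close> with \<open>\<bar>F n\<bar> \<le> 2 \<bar>f\<bar>\<close>, the norm of \<open>f - F n\<close> is small
  since \<open>\<bar>f - F n\<bar> \<le> 3 \<bar>f\<bar>\<close> on the set where the difference exceeds a given \<open>\<eta>\<close>, and this set shrinks
  to a null set.
\<close>

section \<open>Hilbert transforms of holomorphic boundary values\<close>

text \<open>This is Cauchy's integral formula at the centre. The circle path is parametrized over
  \<open>{0..2*pi}\<close>, so the formula is applied to \<open>g\<close> reflected at the origin;
  the shift by \<open>pi\<close> undoes the reflection and moves the interval to
  \<open>{-pi..pi}\<close>, as in the Hilbert transform.\<close>

lemma has_integral_circle_mean:
  fixes g :: "complex \<Rightarrow> complex"
  assumes "continuous_on (cball 0 1) g" and "g holomorphic_on ball 0 1"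
  shows "((\<lambda>t. g (cis t)) has_integral 2 * pi * g 0) {-pi..pi}"
proof -
  define G where "G w = g (- w)" for w
  have "continuous_on (cball 0 1) G" unfolding G_def
    by (rule continuous_on_compose2[OF assms(1)]) (auto intro!: continuous_intros)
  moreover have "G holomorphic_on ball 0 1" unfolding G_def
    by (rule holomorphic_on_compose_gen[OF _ assms(2), of uminus, unfolded o_def])
       (auto intro!: holomorphic_intros)
  ultimately have "((\<lambda>u. G u / (u - 0)) has_contour_integral (2 * of_real pi * \<i> * G 0)) (circlepath 0 1)"
    by (intro Cauchy_integral_circlepath) auto
  then have "((\<lambda>t. G (cis t) * \<i>) has_integral 2 * of_real pi * \<i> * G 0) {0..2*pi}"
    by (simp add: circlepath_def has_contour_integral_part_circlepath_iff)
  then have "((\<lambda>t. - \<i> * (G (cis t) * \<i>)) has_integral - \<i> * (2 * of_real pi * \<i> * G 0)) {0..2*pi}"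
    by (rule has_integral_mult_right)
  then have "((\<lambda>t. G (cis t)) has_integral 2 * pi * g 0) (cbox 0 (2*pi))"
    by (simp add: G_def algebra_simps)
  from has_integral_affinity'[OF this, of 1 pi]
  have "((\<lambda>t. G (cis (t + pi))) has_integral 2 * pi * g 0) {-pi..pi}"
    by simp
  moreover have "G (cis (t + pi)) = g (cis t)" for t
    by (simp add: G_def cis_mult[symmetric])
  ultimately show ?thesis by simp
qed

text \<open>With midpoint \<open>m\<close> and half difference \<open>x\<close>, the difference and
  the sum of \<open>cis a\<close> and \<open>cis b\<close> are
  \<open>2 * \<i> * sin x * cis m\<close> and \<open>2 * cos x * cis m\<close>. The identity serves
  to cancel the singularity of the kernel against a factor \<open>cis a - cis b\<close>.\<close>

lemma cot_half_diff_mult: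
  assumes "sin ((a - b) / 2) \<noteq> 0"
  shows "of_real (cot ((a - b) / 2)) * (cis a - cis b) = \<i> * (cis a + cis b)"
proof -
  define x m where "x = (a - b) / 2" and "m = (a + b) / 2"
  have a: "cis a = cis m * cis x" and b: "cis b = cis m * cis (- x)"
    by (simp_all add: cis_mult x_def m_def field_simps)
  have "cis x - cis (- x) = 2 * \<i> * of_real (sin x)" "cis x + cis (- x) = 2 * of_real (cos x)"
    by (simp_all add: complex_eq_iff)
  then have "cis a - cis b = cis m * (2 * \<i> * of_real (sin x))" "cis a + cis b = cis m * (2 * of_real (cos x))"
    unfolding a b by (simp_all flip: right_diff_distrib distrib_left)
  moreover have "sin x \<noteq> 0" using assms by (simp add: x_def)
  ultimately show ?thesis
    unfolding x_def[symmetric] by (simp add: cot_def field_simps)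
qed

text \<open>An antiderivative is \<open>- 2 * ln (sin ((c - t) / 2))\<close>; the bounds keep
  \<open>(c - t) / 2\<close> strictly between 0 and \<open>pi\<close>, where the sine is
  positive.\<close>

lemma has_integral_cot_left:
  assumes "a \<le> b" "b < c" "c < a + 2 * pi"
  shows "((\<lambda>t. cot ((c - t) / 2)) has_integral
           2 * ln (sin ((c - a) / 2)) - 2 * ln (sin ((c - b) / 2))) {a..b}"
proof -
  have pos: "sin ((c - t) / 2) > 0" if "t \<in> {a..b}" for t
    using that assms by (intro sin_gt_zero) auto
  have "((\<lambda>t. cot ((c - t) / 2)) has_integral
           (- 2 * ln (sin ((c - b) / 2))) - (- 2 * ln (sin ((c - a) / 2)))) {a..b}"
  proof (rule fundamental_theorem_of_calculus)
    fix t assume t: "t \<in> {a..b}"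
    from pos[OF t] show "((\<lambda>t. - 2 * ln (sin ((c - t) / 2))) has_vector_derivative cot ((c - t) / 2)) (at t within {a..b})"
      unfolding has_real_derivative_iff_has_vector_derivative[symmetric] cot_def
      by (auto intro!: derivative_eq_intros simp: field_simps)
  qed fact
  then show ?thesis by (simp add: algebra_simps)
qed

text \<open>To the right of the singularity the antiderivative uses
  \<open>sin ((t - c) / 2)\<close>, which keeps the argument of the logarithm positive; the
  cotangent is odd.\<close>

lemma has_integral_cot_right:
  assumes "a \<le> b" "c < a" "b < c + 2 * pi"
  shows "((\<lambda>t. cot ((c - t) / 2)) has_integral
           2 * ln (sin ((a - c) / 2)) - 2 * ln (sin ((b - c) / 2))) {a..b}"
proof -
  have pos: "sin ((t - c) / 2) > 0" if "t \<in> {a..b}" for t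
    using that assms by (intro sin_gt_zero) auto
  have cot: "cot ((c - t) / 2) = - cot ((t - c) / 2)" for t
    using cot_minus[of "(t - c) / 2"] by (simp add: minus_divide_left)
  have "((\<lambda>t. cot ((c - t) / 2)) has_integral
           (- 2 * ln (sin ((b - c) / 2))) - (- 2 * ln (sin ((a - c) / 2)))) {a..b}"
  proof (rule fundamental_theorem_of_calculus)
    fix t assume t: "t \<in> {a..b}"
    from pos[OF t] show "((\<lambda>t. - 2 * ln (sin ((t - c) / 2))) has_vector_derivative cot ((c - t) / 2)) (at t within {a..b})"
      unfolding has_real_derivative_iff_has_vector_derivative[symmetric] cot
      unfolding cot_def
      by (auto intro!: derivative_eq_intros simp: field_simps)
  qed fact
  then show ?thesis by (simp add: algebra_simps)
qed

text \<open>The function \<open>- \<i> * H\<close> has real part \<open>Im H\<close> and imaginary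
  part \<open>- Re H\<close>; the transform is this harmonic conjugate, normalized to vanish at 0.
  The point -1 is left out because \<open>Arg\<close> is \<open>pi\<close> there and the truncation
  cuts away only one side of the singularity.\<close>

lemma hilbert_transform_Im:
  assumes "H holomorphic_on U" "open U" "cball 0 1 \<subseteq> U" "z \<in> sphere 0 1" "z \<noteq> -1"
  shows "hilbert_transform (\<lambda>w. of_real (Im (H w))) z = of_real (Re (H 0) - Re (H z))"
proof -
  have sph: "sphere 0 1 \<subseteq> U" using assms(3) by auto
  define c where "c = Arg z"
  have z: "z = cis c"
    using assms(4) cis_Arg[of z] unfolding c_def by (cases "z = 0") (auto simp: sgn_div_norm)
  have "c \<noteq> pi" using assms(5) z by auto
  then have c: "-pi < c" "c < pi"
    using Arg_bounded[of z] unfolding c_def by auto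
  text \<open>
    On the circle, \<open>(H w - H z) cot ((Arg z - Arg w) / 2) = - \<i> Q w (z + w)\<close>, so subtracting \<open>H z\<close>
    turns the singular integral into the mean of a holomorphic function; the subtracted term does
    not contribute, the truncated integrals of the cotangent being zero.
  \<close>
  define Q where "Q w = (if w = z then deriv H z else (H w - H z) / (w - z))" for w
  have "z \<in> interior U" using assms by (auto simp: interior_open subset_iff)
  then have holQ: "Q holomorphic_on U"
    unfolding Q_def by (intro pole_lemma[OF assms(1)])
  define g where "g w = - \<i> * Q w * (z + w)" for w
  have holg: "g holomorphic_on U" unfolding g_def by (intro holomorphic_intros holQ)
  have z0: "z \<noteq> 0" using assms by auto
  \<comment> \<open>The imaginary part of this value is \<open>Re (H 0) - Re (H z)\<close>, the
    asserted transform.\<close>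
  then have g0: "g 0 = \<i> * (H 0 - H z)" by (simp add: g_def Q_def field_simps)
  define \<gamma> where "\<gamma> t = Im (g (cis t))" for t
  have "((\<lambda>t. g (cis t)) has_integral 2 * pi * g 0) {-pi..pi}"
    using assms(3) holg by (intro has_integral_circle_mean)
      (auto intro!: holomorphic_on_imp_continuous_on elim!: holomorphic_on_subset)
  then have int\<gamma>: "(\<gamma> has_integral 2 * pi * (Re (H 0) - Re (H z))) {-pi..pi}"
    unfolding \<gamma>_def by (drule_tac has_integral_linear[OF _ bounded_linear_Im]) (simp add: o_def g0)
  have cont\<gamma>: "continuous_on A \<gamma>" for A
  proof -
    have "continuous_on (sphere 0 1) g"
      using holg sph by (intro holomorphic_on_imp_continuous_on) (rule holomorphic_on_subset)
    then show ?thesis unfolding \<gamma>_def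
      by (rule continuous_on_Im[OF continuous_on_compose2[of "sphere 0 1" g]]) (auto intro!: continuous_intros)
  qed
  define k where "k t = Im (H (cis t)) * cot ((c - t) / 2)" for t
  have k_eq: "k t = \<gamma> t + Im (H z) * cot ((c - t) / 2)" if "t \<in> {-pi..pi}" "t \<noteq> c" for t
  proof -
    have sin: "sin ((c - t) / 2) \<noteq> 0"
    proof (cases "t < c")
      case True
      then have "sin ((c - t) / 2) > 0" using c that by (intro sin_gt_zero) auto
      then show ?thesis by simp
    next
      case False
      then have "sin ((t - c) / 2) > 0" using c that by (intro sin_gt_zero) auto
      moreover have "sin ((c - t) / 2) = - sin ((t - c) / 2)"
        using sin_minus[of "(t - c) / 2"] by (simp add: minus_divide_left)
      ultimately show ?thesis by simp
    qed
    note eq = cot_half_diff_mult[OF sin, folded z]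
    have ne: "cis t \<noteq> z"
    proof
      assume "cis t = z"
      with eq z0 show False by simp
    qed
    have "H (cis t) - H z = Q (cis t) * (cis t - z)"
      using ne by (simp add: Q_def)
    also have "\<dots> = - Q (cis t) * (z - cis t)"
      by (simp add: right_diff_distrib)
    finally have "of_real (cot ((c - t) / 2)) * (H (cis t) - H z) = of_real (cot ((c - t) / 2)) * (- Q (cis t) * (z - cis t))"
      by (rule arg_cong)
    also have "\<dots> = - Q (cis t) * (of_real (cot ((c - t) / 2)) * (z - cis t))"
      by (simp only: mult_ac)
    also have "\<dots> = g (cis t)"
      unfolding eq by (simp add: g_def mult.assoc mult.left_commute)
    finally have "Im (of_real (cot ((c - t) / 2)) * (H (cis t) - H z)) = \<gamma> t"
      by (simp add: \<gamma>_def)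
    then show ?thesis by (simp add: k_def algebra_simps)
  qed
  have contH: "continuous_on A (\<lambda>t. Im (H (cis t)))" for A
  proof -
    have "continuous_on (sphere 0 1) H"
      using assms(1) sph by (intro holomorphic_on_imp_continuous_on) (rule holomorphic_on_subset)
    then show ?thesis
      by (rule continuous_on_Im[OF continuous_on_compose2[of "sphere 0 1" H]]) (auto intro!: continuous_intros)
  qed
  \<comment> \<open>The bound on \<open>\<epsilon>\<close> keeps the removed window around
    \<open>c\<close> inside \<open>{-pi..pi}\<close>, so what remains is one interval on each
    side.\<close>
  have L: "(LINT \<theta>:{\<theta> \<in> {-pi..pi}. \<epsilon> \<le> \<bar>\<theta> - Arg z\<bar>}|lebesgue.
       of_real (Im (H (cis \<theta>))) * complex_of_real (cot ((Arg z - \<theta>) / 2)))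
     = of_real (integral {-pi..c-\<epsilon>} \<gamma> + integral {c+\<epsilon>..pi} \<gamma>)"
    if e: "0 < \<epsilon>" "\<epsilon> < min (c + pi) (pi - c)" for \<epsilon>
  proof -
    have S: "{\<theta> \<in> {-pi..pi}. \<epsilon> \<le> \<bar>\<theta> - c\<bar>} = {-pi..c-\<epsilon>} \<union> {c+\<epsilon>..pi}"
      using e c by auto
    have kc: "continuous_on {-pi..c-\<epsilon>} k" "continuous_on {c+\<epsilon>..pi} k"
    proof -
      have cc: "continuous_on A (\<lambda>t. \<gamma> t + Im (H z) * cot ((c - t) / 2))"
        if "\<And>t. t \<in> A \<Longrightarrow> sin ((c - t) / 2) \<noteq> 0" for A
        using that unfolding cot_def by (auto intro!: continuous_intros cont\<gamma>)
      have "sin ((c - t) / 2) > 0" if "t \<in> {-pi..c-\<epsilon>}" for t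
        using that c e by (intro sin_gt_zero) auto
      then have "continuous_on {-pi..c-\<epsilon>} (\<lambda>t. \<gamma> t + Im (H z) * cot ((c - t) / 2))"
        by (intro cc) force
      then show "continuous_on {-pi..c-\<epsilon>} k"
        by (rule continuous_on_cong[THEN iffD1, rotated -1]) (use e c in \<open>auto simp: k_eq\<close>)
      have "sin ((t - c) / 2) > 0" if "t \<in> {c+\<epsilon>..pi}" for t
        using that c e by (intro sin_gt_zero) auto
      moreover have "sin ((c - t) / 2) = - sin ((t - c) / 2)" for t
        using sin_minus[of "(t - c) / 2"] by (simp add: minus_divide_left)
      ultimately have "continuous_on {c+\<epsilon>..pi} (\<lambda>t. \<gamma> t + Im (H z) * cot ((c - t) / 2))"
        by (intro cc) force
      then show "continuous_on {c+\<epsilon>..pi} k"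
        by (rule continuous_on_cong[THEN iffD1, rotated -1]) (use e c in \<open>auto simp: k_eq\<close>)
    qed
    \<comment> \<open>The transform is a Lebesgue integral and the computation below uses the gauge
      integral; absolute integrability of \<open>k\<close> identifies the two.\<close>
    have ints: "set_integrable lebesgue ({-pi..c-\<epsilon>} \<union> {c+\<epsilon>..pi}) k"
      by (intro set_integrable_Un absolutely_integrable_continuous_real kc) auto
    have i1: "(k has_integral integral {-pi..c-\<epsilon>} \<gamma> +
        Im (H z) * (2 * ln (sin ((c - -pi) / 2)) - 2 * ln (sin ((c - (c-\<epsilon>)) / 2)))) {-pi..c-\<epsilon>}"
      by (rule has_integral_eq[OF _ has_integral_add[OF integrable_integral[OF integrable_continuous_real[OF cont\<gamma>]]
          has_integral_mult_right[OF has_integral_cot_left]]]) (use c e in \<open>auto simp: k_eq\<close>)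
    have i2: "(k has_integral integral {c+\<epsilon>..pi} \<gamma> +
        Im (H z) * (2 * ln (sin ((c+\<epsilon> - c) / 2)) - 2 * ln (sin ((pi - c) / 2)))) {c+\<epsilon>..pi}"
      by (rule has_integral_eq[OF _ has_integral_add[OF integrable_integral[OF integrable_continuous_real[OF cont\<gamma>]]
          has_integral_mult_right[OF has_integral_cot_right]]]) (use c e in \<open>auto simp: k_eq\<close>)
    \<comment> \<open>The outer endpoints both give \<open>cos (c / 2)\<close> and the inner ones
      both give \<open>sin (\<epsilon> / 2)\<close>, so the logarithms from the two sides
      cancel.\<close>
    have "sin ((c - -pi) / 2) = cos (c / 2)"
      by (simp add: add_divide_distrib sin_add)
    moreover have "sin ((pi - c) / 2) = cos (c / 2)"
      by (simp add: diff_divide_distrib sin_diff)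
    ultimately have "(k has_integral integral {-pi..c-\<epsilon>} \<gamma> + integral {c+\<epsilon>..pi} \<gamma>) ({-pi..c-\<epsilon>} \<union> {c+\<epsilon>..pi})"
      using has_integral_Un[OF i1 i2] e by (auto simp: algebra_simps)
    then have "(LINT t:({-pi..c-\<epsilon>} \<union> {c+\<epsilon>..pi})|lebesgue. k t) = integral {-pi..c-\<epsilon>} \<gamma> + integral {c+\<epsilon>..pi} \<gamma>"
      using set_lebesgue_integral_eq_integral(2)[OF ints] by (simp add: integral_unique)
    then show ?thesis
      unfolding c_def[symmetric] S by (simp add: k_def[symmetric] set_integral_complex_of_real flip: of_real_mult of_real_add)
  qed
  have \<gamma>i: "\<gamma> integrable_on {-pi..pi}" using int\<gamma> by blast
  have near: "eventually (\<lambda>\<epsilon>. \<epsilon> \<in> {0<..<min (c + pi) (pi - c)}) (at_right (0::real))"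
    using c by (intro eventually_at_right_real) auto
  \<comment> \<open>Since \<open>\<gamma>\<close> has no singularity at \<open>c\<close>, the gap
    closes in the limit and the integral over all of \<open>{-pi..pi}\<close> remains.\<close>
  have "((\<lambda>\<epsilon>. integral {-pi..c-\<epsilon>} \<gamma>) \<longlongrightarrow> integral {-pi..c} \<gamma>) (at_right 0)"
  proof (rule continuous_on_tendsto_compose[OF indefinite_integral_continuous_1[OF \<gamma>i]])
    show "((\<lambda>\<epsilon>. c - \<epsilon>) \<longlongrightarrow> c) (at_right 0)" by (auto intro!: tendsto_eq_intros)
    from near show "\<forall>\<^sub>F \<epsilon> in at_right 0. c - \<epsilon> \<in> {-pi..pi}"
      by eventually_elim (use c in auto)
  qed (use c in auto)
  moreover have "((\<lambda>\<epsilon>. integral {c+\<epsilon>..pi} \<gamma>) \<longlongrightarrow> integral {c..pi} \<gamma>) (at_right 0)"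
  proof (rule continuous_on_tendsto_compose[OF indefinite_integral_continuous_1'[OF \<gamma>i]])
    show "((\<lambda>\<epsilon>. c + \<epsilon>) \<longlongrightarrow> c) (at_right 0)" by (auto intro!: tendsto_eq_intros)
    from near show "\<forall>\<^sub>F \<epsilon> in at_right 0. c + \<epsilon> \<in> {-pi..pi}"
      by eventually_elim (use c in auto)
  qed (use c in auto)
  ultimately have "((\<lambda>\<epsilon>. of_real (integral {-pi..c-\<epsilon>} \<gamma> + integral {c+\<epsilon>..pi} \<gamma>) :: complex) \<longlongrightarrow>
      of_real (integral {-pi..c} \<gamma> + integral {c..pi} \<gamma>)) (at_right 0)"
    by (intro tendsto_intros)
  also have "integral {-pi..c} \<gamma> + integral {c..pi} \<gamma> = integral {-pi..pi} \<gamma>"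
    using c by (intro Henstock_Kurzweil_Integration.integral_combine \<gamma>i) auto
  also have "\<dots> = 2 * pi * (Re (H 0) - Re (H z))"
    using int\<gamma> by (rule integral_unique)
  finally have lim: "((\<lambda>\<epsilon>. of_real (integral {-pi..c-\<epsilon>} \<gamma> + integral {c+\<epsilon>..pi} \<gamma>) :: complex) \<longlongrightarrow>
      of_real (2 * pi * (Re (H 0) - Re (H z)))) (at_right 0)" .
  from near have "\<forall>\<^sub>F \<epsilon> in at_right 0. of_real (integral {-pi..c-\<epsilon>} \<gamma> + integral {c+\<epsilon>..pi} \<gamma>) =
     (LINT \<theta>:{\<theta> \<in> {-pi..pi}. \<epsilon> \<le> \<bar>\<theta> - Arg z\<bar>}|lebesgue.
       of_real (Im (H (cis \<theta>))) * complex_of_real (cot ((Arg z - \<theta>) / 2)))"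
    by eventually_elim (rule L[symmetric], auto)
  from Lim_transform_eventually[OF lim this]
  have "Lim (at_right 0) (\<lambda>\<epsilon>. LINT \<theta>:{\<theta> \<in> {-pi..pi}. \<epsilon> \<le> \<bar>\<theta> - Arg z\<bar>}|lebesgue.
       of_real (Im (H (cis \<theta>))) * complex_of_real (cot ((Arg z - \<theta>) / 2)))
    = of_real (2 * pi * (Re (H 0) - Re (H z)))"
    by (intro tendsto_Lim) (auto simp: trivial_limit_at_right_real)
  then show ?thesis
    by (simp add: hilbert_transform_def field_simps)
qed

section \<open>Real polynomials on the circle as real parts of entire functions\<close>

text \<open>On the circle \<open>cnj z\<close> is the inverse of \<open>z\<close>, so
  \<open>Re z\<close> is \<open>(z + 1 / z) / 2\<close> and \<open>Im z\<close> is
  \<open>(z - 1 / z) / (2 * \<i>)\<close>. A real polynomial in these is a Laurent polynomial in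
  \<open>z\<close>, and the factor \<open>z ^ n\<close> clears its negative powers.\<close>

lemma laurent_polynomial_on_circle:
  assumes "real_polynomial_function q"
  shows "\<exists>n P. \<forall>z\<in>sphere 0 1. complex_of_real (q z) * z ^ n = poly P z"
  using assms
proof induction
  case (linear f)
  interpret bounded_linear f by fact
  have "complex_of_real (f z) * z ^ 1 =
     poly [:of_real (f 1) / 2 - of_real (f \<i>) / (2 * \<i>), 0, of_real (f 1) / 2 + of_real (f \<i>) / (2 * \<i>):] z"
    if z: "z \<in> sphere 0 1" for z
  proof -
    have "z * cnj z = 1" using z by (simp add: complex_norm_square[symmetric])
    have "2 * of_real (Re z) * z = (z + cnj z) * z" by (simp add: complex_add_cnj)
    also have "\<dots> = z\<^sup>2 + z * cnj z" by (simp add: power2_eq_square ring_distribs)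
    finally have re: "2 * of_real (Re z) * z = z\<^sup>2 + 1" unfolding \<open>z * cnj z = 1\<close> .
    have "2 * \<i> * of_real (Im z) * z = (z - cnj z) * z" by (simp add: complex_diff_cnj)
    also have "\<dots> = z\<^sup>2 - z * cnj z" by (simp add: power2_eq_square ring_distribs)
    finally have im: "2 * \<i> * of_real (Im z) * z = z\<^sup>2 - 1" unfolding \<open>z * cnj z = 1\<close> .
    have "f z = f (Re z *\<^sub>R 1 + Im z *\<^sub>R \<i>)"
      by (intro arg_cong[of _ _ f]) (simp add: complex_eq_iff)
    then have "f z = Re z * f 1 + Im z * f \<i>" by (simp only: add scaleR real_scaleR_def)
    then have "complex_of_real (f z) * z = of_real (f 1) * of_real (Re z) * z + of_real (f \<i>) * of_real (Im z) * z"
      by (simp add: ring_distribs mult_ac)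
    also have "of_real (f 1) * of_real (Re z) * z = of_real (f 1) / 2 * (2 * of_real (Re z) * z)" by simp
    also have "of_real (f \<i>) * of_real (Im z) * z = of_real (f \<i>) / (2 * \<i>) * (2 * \<i> * of_real (Im z) * z)"
    proof -
      have "of_real (f \<i>) / (2 * \<i>) * (2 * \<i>) = complex_of_real (f \<i>)"
        by (rule nonzero_eq_divide_eq[THEN iffD1, OF _ refl]) simp
      then show ?thesis by (simp only: mult.assoc[symmetric])
    qed
    finally have "complex_of_real (f z) * z = of_real (f 1) / 2 * (2 * of_real (Re z) * z)
        + of_real (f \<i>) / (2 * \<i>) * (2 * \<i> * of_real (Im z) * z)" .
    then show ?thesis unfolding re im by (simp add: algebra_simps power2_eq_square add_divide_distrib diff_divide_distrib)
  qed
  then show ?case by blast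
next
  case (const c)
  have "\<forall>z\<in>sphere 0 1. complex_of_real c * z ^ 0 = poly [:of_real c:] z" by simp
  then show ?case by blast
next
  case (add f g)
  then obtain n P m R where *: "\<And>z. z \<in> sphere 0 1 \<Longrightarrow> complex_of_real (f z) * z ^ n = poly P z"
    "\<And>z. z \<in> sphere 0 1 \<Longrightarrow> complex_of_real (g z) * z ^ m = poly R z" by meson
  have "complex_of_real (f z + g z) * z ^ (n + m) = poly (P * monom 1 m + R * monom 1 n) z"
    if "z \<in> sphere 0 1" for z
    unfolding poly_add poly_mult poly_monom *[OF that, symmetric] by (simp add: algebra_simps power_add)
  then show ?case by blast
next
  case (mult f g)
  then obtain n P m R where *: "\<And>z. z \<in> sphere 0 1 \<Longrightarrow> complex_of_real (f z) * z ^ n = poly P z"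
    "\<And>z. z \<in> sphere 0 1 \<Longrightarrow> complex_of_real (g z) * z ^ m = poly R z" by meson
  have "complex_of_real (f z * g z) * z ^ (n + m) = poly (P * R) z"
    if "z \<in> sphere 0 1" for z
    unfolding poly_mult *[OF that, symmetric] by (simp add: algebra_simps power_add)
  then show ?case by blast
qed

text \<open>This turns a Weierstrass approximant, known only as a real polynomial function, into
  boundary values of the real part of an entire function, so that the mean value property and the
  maximum principle become available.\<close>

lemma real_polynomial_eq_Re_holomorphic:
  assumes "real_polynomial_function q"
  obtains p where "p holomorphic_on UNIV" "\<And>z. z \<in> sphere 0 1 \<Longrightarrow> q z = Re (p z)"
proof -
  obtain n P where P: "\<And>z. z \<in> sphere 0 1 \<Longrightarrow> complex_of_real (q z) * z ^ n = poly P z"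
    using laurent_polynomial_on_circle[OF assms] by blast
  text \<open>The terms of negative degree are replaced by their conjugates, which have the same real part.\<close>
  define p where "p z = (\<Sum>k\<le>degree P. if n \<le> k then coeff P k * z ^ (k - n) else cnj (coeff P k) * z ^ (n - k))" for z
  show ?thesis
  proof
    have "(\<lambda>z. if n \<le> k then coeff P k * z ^ (k - n) else cnj (coeff P k) * z ^ (n - k)) holomorphic_on UNIV" for k
      by (cases "n \<le> k") (auto intro!: holomorphic_intros)
    then show "p holomorphic_on UNIV"
      unfolding p_def by (intro holomorphic_on_sum)
  next
    fix z :: complex assume z: "z \<in> sphere 0 1"
    then have zc: "z * cnj z = 1" by (simp add: complex_norm_square[symmetric])
    \<comment> \<open>Multiplying by \<open>cnj z ^ n\<close> divides out the factor
      \<open>z ^ n\<close> of \<open>P\<close>.\<close>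
    have "complex_of_real (q z) = complex_of_real (q z) * (z * cnj z) ^ n" by (simp add: zc)
    also have "\<dots> = poly P z * cnj z ^ n" by (simp add: power_mult_distrib P[OF z, symmetric])
    also have "\<dots> = (\<Sum>k\<le>degree P. coeff P k * z ^ k * cnj z ^ n)"
      by (simp add: poly_altdef sum_distrib_right)
    finally have "q z = Re (\<Sum>k\<le>degree P. coeff P k * z ^ k * cnj z ^ n)"
      by (drule_tac arg_cong[of _ _ Re]) (simp only: Re_complex_of_real)
    also have "\<dots> = (\<Sum>k\<le>degree P. Re (if n \<le> k then coeff P k * z ^ (k - n) else cnj (coeff P k) * z ^ (n - k)))"
      unfolding Re_sum
    proof (rule sum.cong[OF refl])
      fix k
      show "Re (coeff P k * z ^ k * cnj z ^ n) = Re (if n \<le> k then coeff P k * z ^ (k - n) else cnj (coeff P k) * z ^ (n - k))"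
      proof (cases "n \<le> k")
        case True
        then have "z ^ k * cnj z ^ n = z ^ (k - n) * (z * cnj z) ^ n"
          by (simp add: power_mult_distrib flip: power_add mult.assoc)
        with True show ?thesis by (simp add: zc mult.assoc)
      next
        case False
        then have "cnj z ^ n = cnj z ^ (n - k) * cnj z ^ k"
          by (simp flip: power_add)
        then have "z ^ k * cnj z ^ n = cnj z ^ (n - k) * (z * cnj z) ^ k"
          by (simp only: power_mult_distrib mult_ac)
        then have "coeff P k * z ^ k * cnj z ^ n = cnj (cnj (coeff P k) * z ^ (n - k))"
          by (simp add: zc mult.assoc)
        then have "Re (coeff P k * z ^ k * cnj z ^ n) = Re (cnj (coeff P k) * z ^ (n - k))"
          by (simp only: cnj.sel(1))
        with False show ?thesis by simp
      qed
    qed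
    finally show "q z = Re (p z)" by (simp add: p_def)
  qed
qed

section \<open>Measure and integration on the circle\<close>

text \<open>The measure before completion: continuous functions and Borel sets are treated here, and
  the results are then carried over to \<open>circle\<close>.\<close>

definition circle_borel :: "complex measure" where
  "circle_borel = distr (uniform_measure lborel {-pi..pi}) (restrict_space borel (sphere 0 1)) cis"

lemma circle_eq_completion: "circle = completion circle_borel"
  by (simp add: circle_def circle_borel_def)

lemma sets_circle_borel: "sets circle_borel = sets (restrict_space borel (sphere 0 1))"
  by (simp add: circle_borel_def)

lemma measurable_cis_borel [measurable]: "cis \<in> borel_measurable borel"
  by (intro borel_measurable_continuous_onI continuous_intros)

lemma measurable_cis_sphere: "cis \<in> uniform_measure lborel {-pi..pi} \<rightarrow>\<^sub>M restrict_space borel (sphere 0 1)"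
  by (intro measurable_restrict_space2) auto

lemma borel_measurable_circle_borelI:
  fixes f :: "complex \<Rightarrow> 'a::topological_space"
  assumes "continuous_on (sphere 0 1) f"
  shows "f \<in> borel_measurable circle_borel"
  using borel_measurable_continuous_on_restrict[OF assms]
  by (simp add: circle_borel_def)

lemma borel_measurable_circleI:
  fixes f :: "complex \<Rightarrow> 'a::topological_space"
  assumes "continuous_on (sphere 0 1) f"
  shows "f \<in> borel_measurable circle"
  unfolding circle_eq_completion
  by (intro measurable_completion borel_measurable_circle_borelI assms)

lemma sets_circleI:
  assumes "A \<in> sets borel" "A \<subseteq> sphere 0 1"
  shows "A \<in> sets circle"
  using assms unfolding circle_eq_completion
  by (intro sets_completionI_sets) (auto simp: sets_circle_borel sets_restrict_space_iff)

text \<open>Undoing the completion and then the image under \<open>cis\<close> leaves Lebesgue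
  measure on \<open>{-pi..pi}\<close> with density \<open>1 / (2 * pi)\<close>. The right side is a
  gauge integral, the form in which \<open>has_integral_circle_mean\<close> gives its value.\<close>

lemma integral_circle:
  fixes f :: "complex \<Rightarrow> real"
  assumes "continuous_on (sphere 0 1) f"
  shows "integral\<^sup>L circle f = integral {-pi..pi} (\<lambda>t. f (cis t)) / (2 * pi)"
proof -
  have fc: "continuous_on A (\<lambda>t. f (cis t))" for A
    by (rule continuous_on_compose2[OF assms]) (auto intro!: continuous_intros)
  then have [measurable]: "(\<lambda>t. f (cis t)) \<in> borel_measurable borel"
    by (intro borel_measurable_continuous_onI)
  have "integral\<^sup>L circle f = integral\<^sup>L circle_borel f"
    unfolding circle_eq_completion
    by (intro integral_completion borel_measurable_circle_borelI assms)
  also have "\<dots> = (\<integral>t. f (cis t) \<partial>uniform_measure lborel {-pi..pi})"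
    unfolding circle_borel_def
    by (intro integral_distr measurable_cis_sphere borel_measurable_continuous_on_restrict assms)
  also have "uniform_measure lborel {-pi..pi} = density lborel (\<lambda>t. ennreal (indicator {-pi..pi} t / (2 * pi)))"
    unfolding uniform_measure_def
    by (intro density_cong) (auto simp: indicator_def divide_ennreal[of 1 "2 * pi", simplified])
  also have "(\<integral>t. f (cis t) \<partial>density lborel (\<lambda>t. ennreal (indicator {-pi..pi} t / (2 * pi)))) =
      (\<integral>t. (indicator {-pi..pi} t / (2 * pi)) *\<^sub>R f (cis t) \<partial>lborel)"
    by (intro integral_density) auto
  also have "\<dots> = (LINT t:{-pi..pi}|lborel. f (cis t)) / (2 * pi)"
    unfolding set_lebesgue_integral_def by (simp flip: integral_divide_zero)
  also have "(LINT t:{-pi..pi}|lborel. f (cis t)) = integral {-pi..pi} (\<lambda>t. f (cis t))"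
    by (intro set_borel_integral_eq_integral borel_integrable_atLeastAtMost') (rule fc)
  finally show ?thesis .
qed

text \<open>In \<open>{-pi..pi}\<close> only the two endpoints are mapped to -1 by
  \<open>cis\<close>. The point excluded from \<open>hilbert_transform_Im\<close> is therefore
  negligible.\<close>

lemma AE_circle_neq_minus_one: "AE z in circle. z \<noteq> -1"
proof -
  have "AE t in lborel. t \<noteq> pi \<and> t \<noteq> -pi"
    using AE_lborel_singleton[of pi] AE_lborel_singleton[of "-pi"] by eventually_elim simp
  then have "AE t in lborel. t \<in> {-pi..pi} \<longrightarrow> cis t \<noteq> -1"
  proof eventually_elim
    case (elim t)
    show ?case
    proof
      assume "t \<in> {-pi..pi}"
      with elim have "Arg (cis t) = t" by (intro Arg_cis) auto
      moreover have "Arg (-1) = pi" using Arg_cis[of pi] by simp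
      ultimately show "cis t \<noteq> -1" using elim by auto
    qed
  qed
  then have "AE t in uniform_measure lborel {-pi..pi}. cis t \<noteq> -1"
    by (intro AE_uniform_measureI) auto
  moreover have "{z \<in> space (restrict_space borel (sphere 0 1)). z \<noteq> -1} \<in> sets (restrict_space borel (sphere (0::complex) 1))"
  proof -
    have "{z \<in> space (restrict_space borel (sphere 0 1)). z \<noteq> (-1::complex)} = sphere 0 1 - {-1}"
      by (auto simp: space_restrict_space)
    then show ?thesis by (auto simp: sets_restrict_space_iff)
  qed
  ultimately have "AE z in circle_borel. z \<noteq> -1"
    unfolding circle_borel_def using measurable_cis_sphere by (subst AE_distr_iff)
  then show ?thesis
    unfolding circle_eq_completion by (rule AE_completion)
qed

section \<open>The weak type bound for compact sets of small measure\<close>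

text \<open>Continuous cutoffs \<open>u n\<close> that are 1 on \<open>K\<close> tend to its
  indicator, so some \<open>u n\<close> has mean below \<open>\<delta>\<close>. A polynomial
  slightly above it on the circle is the real part of an entire \<open>p\<close>, and
  \<open>Re (p 0)\<close> is the mean of \<open>Re p\<close>. Nonemptiness of \<open>K\<close> makes
  \<open>infdist\<close> positive off \<open>K\<close>.\<close>

lemma holomorphic_majorant_on_circle:
  assumes "compact K" "K \<subseteq> sphere 0 1" "K \<noteq> {}" "measure circle K < \<delta>"
  obtains p where "p holomorphic_on UNIV" "\<And>z. z \<in> sphere 0 1 \<Longrightarrow> 0 < Re (p z)"
    "\<And>z. z \<in> K \<Longrightarrow> 1 \<le> Re (p z)" "Im (p 0) = 0" "Re (p 0) < \<delta>"
proof -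
  interpret prob_space circle by (rule prob_space_circle)
  have Ksets: "K \<in> sets circle"
    using assms by (intro sets_circleI borel_compact)
  define u where "u n z = max 0 (1 - real n * infdist z K)" for n z
  have ucont: "continuous_on A (u n)" for A n
    unfolding u_def by (intro continuous_intros)
  have ulim: "(\<lambda>n. u n z) \<longlonglongrightarrow> indicator K z" for z
  proof (cases "z \<in> K")
    case True
    then show ?thesis by (simp add: u_def)
  next
    case False
    then have d: "infdist z K > 0"
      using assms by (simp add: infdist_pos_not_in_closed compact_imp_closed)
    obtain N :: nat where N: "1 < real N * infdist z K"
      using reals_Archimedean3[OF d] by blast
    have "u n z = 0" if "n \<ge> N" for n
    proof -
      have "real N * infdist z K \<le> real n * infdist z K"
        using that d by (intro mult_right_mono) auto
      with N show ?thesis by (simp add: u_def)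
    qed
    then have "eventually (\<lambda>n. u n z = indicator K z) sequentially"
      using False by (auto simp: eventually_sequentially)
    then show ?thesis by (rule tendsto_eventually)
  qed
  have u01: "0 \<le> u n z" "u n z \<le> 1" for n z
    by (auto simp: u_def infdist_nonneg)
  have "(\<lambda>n. integral\<^sup>L circle (u n)) \<longlonglongrightarrow> integral\<^sup>L circle (indicator K :: complex \<Rightarrow> real)"
    by (rule integral_dominated_convergence[where w = "\<lambda>_. 1"])
       (use ulim u01 Ksets in \<open>auto intro!: borel_measurable_circleI ucont\<close>)
  also have "integral\<^sup>L circle (indicator K :: complex \<Rightarrow> real) = measure circle K"
    using Ksets assms(2) by (simp add: Int_absorb2)
  finally have "eventually (\<lambda>n. integral\<^sup>L circle (u n) < \<delta>) sequentially"
    using assms(4) by (rule order_tendstoD)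
  then obtain n where n: "integral\<^sup>L circle (u n) < \<delta>"
    by (auto simp: eventually_sequentially)
  text \<open>Approximating \<open>u n + e\<close> within \<open>e\<close> keeps the polynomial strictly above \<open>u n\<close>.\<close>
  define e where "e = (\<delta> - integral\<^sup>L circle (u n)) / 3"
  have e: "e > 0" using n by (simp add: e_def)
  obtain q where q: "real_polynomial_function q" "\<And>z. z \<in> sphere 0 1 \<Longrightarrow> \<bar>u n z + e - q z\<bar> < e"
    by (rule Stone_Weierstrass_real_polynomial_function[of "sphere 0 1" "\<lambda>z. u n z + e" e])
       (use e in \<open>auto intro!: continuous_intros ucont\<close>)
  obtain p where p: "p holomorphic_on UNIV" "\<And>z. z \<in> sphere 0 1 \<Longrightarrow> q z = Re (p z)"
    using real_polynomial_eq_Re_holomorphic[OF q(1)] by blast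
  have up: "u n z \<le> Re (p z)" "Re (p z) \<le> u n z + 2 * e" "Re (p z) \<noteq> u n z" if "z \<in> sphere 0 1" for z
    using q(2)[OF that] p(2)[OF that] by auto
  have pcont: "continuous_on A p" for A
    using p(1) holomorphic_on_imp_continuous_on continuous_on_subset by blast
  have "((\<lambda>t. p (cis t)) has_integral 2 * pi * p 0) {-pi..pi}"
    by (rule has_integral_circle_mean) (auto intro: pcont holomorphic_on_subset[OF p(1)])
  then have "((\<lambda>t. Re (p (cis t))) has_integral 2 * pi * Re (p 0)) {-pi..pi}"
    by (drule_tac has_integral_linear[OF _ bounded_linear_Re]) (simp add: o_def)
  then have "Re (p 0) = integral\<^sup>L circle (\<lambda>z. Re (p z))"
    by (subst integral_circle) (auto intro!: continuous_intros pcont simp: integral_unique)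
  also have "\<dots> \<le> integral\<^sup>L circle (\<lambda>z. u n z + 2 * e)"
  proof (rule integral_mono)
    show "integrable circle (\<lambda>z. u n z + 2 * e)"
    proof (intro integrable_const_bound[where B = "1 + 2 * e"] borel_measurable_circleI AE_I2)
      show "norm (u n z + 2 * e) \<le> 1 + 2 * e" for z using u01[of n z] e by auto
    qed (auto intro!: continuous_intros ucont)
    show "integrable circle (\<lambda>z. Re (p z))"
    proof (intro integrable_const_bound[where B = "1 + 2 * e"] borel_measurable_circleI AE_I2)
      fix z assume "z \<in> space circle"
      then have "z \<in> sphere 0 1" by simp
      from up(1,2)[OF this] u01[of n z] show "norm (Re (p z)) \<le> 1 + 2 * e" by auto
    qed (auto intro!: continuous_intros pcont)
  qed (use up in auto)
  also have "\<dots> = integral\<^sup>L circle (u n) + 2 * e"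
  proof -
    have "integrable circle (u n)"
      by (intro integrable_const_bound[where B = 1] borel_measurable_circleI)
         (use u01 in \<open>auto intro!: ucont\<close>)
    then show ?thesis using prob_space by simp
  qed
  \<comment> \<open>The error \<open>2 * e\<close> uses up only two thirds of the gap between the
    mean of \<open>u n\<close> and \<open>\<delta>\<close>.\<close>
  also have "\<dots> < \<delta>" using n by (simp add: e_def field_simps)
  finally have p0: "Re (p 0) < \<delta>" .
  show ?thesis
  proof
    \<comment> \<open>Subtracting an imaginary constant makes the value at 0 real and leaves all
      real parts unchanged.\<close>
    show "(\<lambda>z. p z - \<i> * of_real (Im (p 0))) holomorphic_on UNIV"
      by (intro holomorphic_intros p)
    show "0 < Re (p z - \<i> * of_real (Im (p 0)))" if "z \<in> sphere 0 1" for z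
      using up[OF that] u01[of n z] by simp
    show "1 \<le> Re (p z - \<i> * of_real (Im (p 0)))" if "z \<in> K" for z
    proof -
      have "u n z = 1" using that by (simp add: u_def)
      then show ?thesis using up[of z] that assms by auto
    qed
    show "Im (p 0 - \<i> * of_real (Im (p 0))) = 0" by simp
    show "Re (p 0 - \<i> * of_real (Im (p 0))) < \<delta>" using p0 by simp
  qed
qed

text \<open>The modulus of \<open>exp (- p z)\<close> is \<open>exp (- Re (p z))\<close>, so the
  maximum modulus principle for this function is a minimum principle for
  \<open>Re p\<close>.\<close>

lemma Re_nonneg_on_disc:
  assumes "p holomorphic_on UNIV" "\<And>z. z \<in> sphere 0 1 \<Longrightarrow> 0 \<le> Re (p z)" "z \<in> cball 0 1"
  shows "0 \<le> Re (p z)"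
proof -
  have "norm (exp (- p z)) \<le> 1"
  proof (rule maximum_modulus_frontier[of "\<lambda>z. exp (- p z)" "cball 0 1"])
    show "(\<lambda>z. exp (- p z)) holomorphic_on interior (cball 0 1)"
      by (intro holomorphic_intros holomorphic_on_subset[OF assms(1)]) auto
    show "continuous_on (closure (cball 0 1)) (\<lambda>z. exp (- p z))"
      by (intro continuous_intros holomorphic_on_imp_continuous_on holomorphic_on_subset[OF assms(1)]) auto
  qed (use assms(2,3) in auto)
  then show ?thesis by simp
qed

lemma X_norm_indicator: "X_norm \<rho> (indicator S) = \<rho> (indicator S)"
  unfolding X_norm_def by (rule arg_cong[of _ _ \<rho>]) (auto simp: indicator_def fun_eq_iff)

text \<open>The test function \<open>Im H\<close> is bounded by \<open>pi\<close> however small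
  \<open>K\<close> is, while its transform exceeds \<open>l\<close> in modulus on \<open>K\<close>,
  except possibly at -1. The weak type inequality at level \<open>l\<close> then gives the
  bound.\<close>

lemma weak_type_compact_bound:
  assumes bfn: "banach_function_norm \<rho>"
    and C: "0 < C" "\<And>l f. 0 < l \<Longrightarrow> f \<in> Linf \<Longrightarrow>
        X_norm \<rho> (indicator {\<zeta> \<in> sphere 0 1. l < cmod (hilbert_transform f \<zeta>)})
          \<le> ennreal C * Linf_norm f / ennreal l"
    and K: "compact K" "K \<subseteq> sphere 0 1" "K \<noteq> {}" "measure circle K < exp (- l) / 2"
    and l: "0 < l"
  shows "\<rho> (indicator K) \<le> ennreal (C * pi / l)"
proof -
  interpret prob_space circle by (rule prob_space_circle)
  text \<open>This \<open>\<delta>\<close> makes \<open>ln (1 + 1 / \<delta>) - ln 2 > l\<close>.\<close>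
  define \<delta> where "\<delta> = exp (- l) / 2"
  have \<delta>: "\<delta> > 0" by (simp add: \<delta>_def)
  obtain p where p: "p holomorphic_on UNIV" "\<And>z. z \<in> sphere 0 1 \<Longrightarrow> 0 < Re (p z)"
    "\<And>z. z \<in> K \<Longrightarrow> 1 \<le> Re (p z)" "Im (p 0) = 0" "Re (p 0) < \<delta>"
    using holomorphic_majorant_on_circle[OF K[folded \<delta>_def]] by blast
  have pdisc: "0 \<le> Re (p z)" if "z \<in> cball 0 1" for z
    by (rule Re_nonneg_on_disc[OF p(1) less_imp_le[OF p(2)] that])
  have pcont: "continuous_on A p" for A
    using p(1) holomorphic_on_imp_continuous_on continuous_on_subset by blast
  define P where "P z = 1 + p z / of_real \<delta>" for z
  have ReP: "Re (P z) = 1 + Re (p z) / \<delta>" for z by (simp add: P_def)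
  \<comment> \<open>On \<open>U\<close> the function \<open>P\<close> avoids the branch cut of
    \<open>Ln\<close>. As \<open>U\<close> is open and contains the closed disc, \<open>H\<close> is
    holomorphic across the circle, as \<open>hilbert_transform_Im\<close> requires.\<close>
  define U where "U = {z. 0 < Re (P z)}"
  have "open U" unfolding U_def ReP
    by (intro open_Collect_less continuous_intros pcont) (use \<delta> in auto)
  have "cball 0 1 \<subseteq> U"
  proof
    fix z :: complex assume "z \<in> cball 0 1"
    then have "0 \<le> Re (p z) / \<delta>" using pdisc \<delta> by simp
    then show "z \<in> U" by (simp add: U_def ReP)
  qed
  define H where "H z = Ln (P z)" for z
  have "P holomorphic_on U" unfolding P_def
    using \<delta> by (intro holomorphic_intros holomorphic_on_subset[OF p(1)]) auto
  then have "H holomorphic_on U" unfolding H_def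
    by (intro holomorphic_intros) (auto simp: U_def complex_nonpos_Reals_iff)
  note HT = hilbert_transform_Im[OF this \<open>open U\<close> \<open>cball 0 1 \<subseteq> U\<close>]
  have sph: "sphere 0 1 \<subseteq> U" using \<open>cball 0 1 \<subseteq> U\<close> by auto
  then have Hcont: "continuous_on (sphere 0 1) H"
    using \<open>H holomorphic_on U\<close> holomorphic_on_imp_continuous_on continuous_on_subset by blast
  define f where "f w = complex_of_real (Im (H w))" for w
  have fm: "f \<in> borel_measurable circle" unfolding f_def
    by (intro borel_measurable_circleI continuous_intros Hcont)
  have "Linf_norm f \<le> ennreal pi"
    unfolding Linf_norm_def
  proof (rule esssup_I)
    show "AE z in circle. ennreal (cmod (f z)) \<le> ennreal pi"
    proof (rule AE_I2, rule ennreal_leI)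
      fix z :: complex assume "z \<in> space circle"
      then have "0 < Re (P z)" using sph by (auto simp: U_def)
      then have "P z \<noteq> 0" by auto
      then show "cmod (f z) \<le> pi"
        using mpi_less_Im_Ln[of "P z"] Im_Ln_le_pi[of "P z"] by (simp add: f_def H_def)
    qed
  qed (use fm in measurable)
  moreover from this have "f \<in> Linf" using fm
    by (auto simp: Linf_def intro: le_less_trans)
  define S where "S = {z \<in> sphere 0 1. l < cmod (hilbert_transform f z)}"
  \<comment> \<open>Measurability of \<open>S\<close> comes from \<open>S'\<close>, which is given
    by a continuous function and can differ from \<open>S\<close> only at -1.\<close>
  define S' where "S' = {z \<in> sphere 0 1. l < \<bar>Re (H 0) - Re (H z)\<bar>}"
  have hf: "cmod (hilbert_transform f z) = \<bar>Re (H 0) - Re (H z)\<bar>" if "z \<in> sphere 0 1" "z \<noteq> -1" for z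
    unfolding f_def HT[OF that] by (rule norm_of_real)
  have "S' \<in> sets circle"
  proof -
    have "(\<lambda>z. \<bar>Re (H 0) - Re (H z)\<bar>) \<in> borel_measurable circle"
      by (intro borel_measurable_circleI continuous_intros Hcont)
    then have "{z \<in> space circle. l < \<bar>Re (H 0) - Re (H z)\<bar>} \<in> sets circle"
      by measurable
    then show ?thesis by (simp add: S'_def)
  qed
  moreover have "S = (S' - {-1}) \<union> (S \<inter> {-1})"
    using hf by (auto simp: S_def S'_def)
  moreover have "S \<inter> {-1} \<in> sets circle" "{-1} \<in> sets circle"
    by (cases "-1 \<in> S"; auto intro!: sets_circleI)+
  ultimately have Ss: "S \<in> sets circle"
    by (metis sets.Diff sets.Un)
  have Ks: "K \<in> sets circle"
    using K by (intro sets_circleI borel_compact)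
  have "AE z in circle. (indicator K z :: ennreal) \<le> indicator S z"
    using AE_circle_neq_minus_one
  proof eventually_elim
    case (elim z)
    show ?case
    proof (cases "z \<in> K")
      case True
      then have z: "z \<in> sphere 0 1" using K by auto
      have "1 + 1 / \<delta> \<le> Re (P z)"
        unfolding ReP using p(3)[OF True] \<delta> by (simp add: divide_right_mono)
      also have "\<dots> \<le> cmod (P z)" by (rule complex_Re_le_cmod)
      finally have "1 + 1 / \<delta> \<le> cmod (P z)" .
      moreover have "0 < 1 + 1 / \<delta>" using \<delta> by (simp add: add_pos_pos)
      ultimately have "ln (1 + 1 / \<delta>) \<le> ln (cmod (P z))"
        by (subst ln_le_cancel_iff) auto
      moreover have "Re (H z) = ln (cmod (P z))"
        unfolding H_def using \<open>1 + 1 / \<delta> \<le> cmod (P z)\<close> \<open>0 < 1 + 1 / \<delta>\<close> by (intro Re_Ln) auto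
      \<comment> \<open>\<open>P 0\<close> is real and lies in \<open>{1..<2}\<close>, because
        \<open>p 0\<close> is real with \<open>0 \<le> Re (p 0) < \<delta>\<close>.\<close>
      moreover have "Re (H 0) \<le> ln 2"
      proof -
        have p0: "0 \<le> Re (p 0) / \<delta>" "Re (p 0) / \<delta> < 1"
          using pdisc[of 0] p(5) \<delta> by auto
        have P0: "P 0 = of_real (1 + Re (p 0) / \<delta>)"
          using p(4) by (simp add: complex_eq_iff P_def)
        then have "H 0 = of_real (ln (1 + Re (p 0) / \<delta>))"
          unfolding H_def P0 using p0 by (intro Ln_of_real) auto
        then have "Re (H 0) = ln (1 + Re (p 0) / \<delta>)" by simp
        also have "\<dots> \<le> ln 2" using p0 by (subst ln_le_cancel_iff) auto
        finally show ?thesis .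
      qed
      moreover have "l + ln 2 < ln (1 + 1 / \<delta>)"
      proof -
        have "1 / \<delta> = exp (l + ln 2)" by (simp add: \<delta>_def exp_minus exp_add field_simps)
        then have "exp (l + ln 2) < 1 + 1 / \<delta>" by simp
        then have "ln (exp (l + ln 2)) < ln (1 + 1 / \<delta>)"
          using \<open>0 < 1 + 1 / \<delta>\<close> by (subst ln_less_cancel_iff) auto
        then show ?thesis by simp
      qed
      ultimately have "l < \<bar>Re (H 0) - Re (H z)\<bar>" by linarith
      then have "z \<in> S" using hf[OF z elim] z by (simp add: S_def)
      then show ?thesis by (simp add: indicator_def)
    qed simp
  qed
  then have "\<rho> (indicator K) \<le> \<rho> (indicator S)"
    using bfn Ks Ss unfolding banach_function_norm_def by auto
  also have "\<dots> = X_norm \<rho> (indicator S)" by (simp add: X_norm_indicator)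
  also have "\<dots> \<le> ennreal C * Linf_norm f / ennreal l"
    unfolding S_def by (rule C(2)) fact+
  also have "\<dots> \<le> ennreal C * ennreal pi / ennreal l"
    by (intro divide_right_mono_ennreal mult_left_mono) (use \<open>Linf_norm f \<le> ennreal pi\<close> in auto)
  also have "\<dots> = ennreal (C * pi / l)"
    using C l by (simp add: ennreal_mult[symmetric] divide_ennreal)
  finally show ?thesis .
qed

section \<open>From compact sets to measurable sets\<close>

text \<open>Up to a null set \<open>E\<close> is a Borel set \<open>A\<close>, and inner regularity
  of finite Borel measures exhausts \<open>A\<close> in measure by compact subsets. Their union then
  fills \<open>A\<close> almost everywhere.\<close>

lemma circle_inner_regular_sequence:
  assumes "E \<in> sets circle"
  obtains L where "\<And>n::nat. compact (L n)" "\<And>n. L n \<subseteq> E" "incseq L"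
    "AE z in circle. (\<lambda>n. indicator (L n) z :: ennreal) \<longlonglongrightarrow> indicator E z"
proof -
  define A where "A = main_part circle_borel E"
  have E': "E \<in> sets (completion circle_borel)" using assms by (simp add: circle_eq_completion)
  have AE: "A \<subseteq> E" "AE z in circle. z \<in> E \<longleftrightarrow> z \<in> A"
  proof -
    show "A \<subseteq> E" using main_part_null_part_Un[OF E'] by (auto simp: A_def)
    have "AE z in circle. z \<notin> null_part circle_borel E"
      unfolding circle_eq_completion by (intro AE_completion AE_notin_null_part E')
    then show "AE z in circle. z \<in> E \<longleftrightarrow> z \<in> A"
      by eventually_elim (use main_part_null_part_Un[OF E'] in \<open>auto simp: A_def\<close>)
  qed
  have "A \<in> sets circle_borel" unfolding A_def using E' by (rule main_part_sets)
  then have A: "A \<in> sets borel" "A \<subseteq> sphere 0 1"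
    by (auto simp: sets_circle_borel sets_restrict_space_iff)
  \<comment> \<open>Inner regularity is applied to a measure on all Borel sets of the plane;
    \<open>N\<close> is that measure and agrees with \<open>circle\<close> on Borel subsets of the
    circle.\<close>
  define N where "N = distr (uniform_measure lborel {-pi..pi}) borel cis"
  interpret N: prob_space N unfolding N_def
    by (intro prob_space.prob_space_distr prob_space_uniform_measure) auto
  have N: "sets N = sets borel" by (simp add: N_def)
  have Ncircle: "emeasure circle B = emeasure N B" if "B \<in> sets borel" "B \<subseteq> sphere 0 1" for B
  proof -
    have "B \<in> sets circle_borel"
      using that by (auto simp: sets_circle_borel sets_restrict_space_iff)
    then have "emeasure circle B = emeasure circle_borel B"
      unfolding circle_eq_completion by simp
    also have "\<dots> = emeasure N B"
      unfolding circle_borel_def N_def using that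
      by (subst (1 2) emeasure_distr) (auto intro: measurable_cis_sphere simp: sets_restrict_space_iff)
    finally show ?thesis .
  qed
  have "emeasure N A = (SUP K \<in> {K. K \<subseteq> A \<and> compact K}. emeasure N K)"
    using N A by (intro inner_regular) auto
  moreover have "\<exists>f::nat \<Rightarrow> ennreal. range f \<subseteq> emeasure N ` {K. K \<subseteq> A \<and> compact K} \<and>
      Sup (emeasure N ` {K. K \<subseteq> A \<and> compact K}) = Sup (range f)"
    by (intro ennreal_SUP_countable_SUP) auto
  ultimately obtain f where f: "range f \<subseteq> emeasure N ` {K. K \<subseteq> A \<and> compact K}"
    "emeasure N A = (SUP n::nat. f n)" by auto
  have "\<exists>K. \<forall>n. K n \<subseteq> A \<and> compact (K n) \<and> f n = emeasure N (K n)"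
    using f(1) by (intro choice) auto
  then obtain K where K: "\<And>n. K n \<subseteq> A" "\<And>n. compact (K n)" "\<And>n. f n = emeasure N (K n)" by blast
  \<comment> \<open>Finite unions keep the sets compact and make the sequence increasing, as (A3)
    demands.\<close>
  define L where "L n = (\<Union>i\<le>n. K i)" for n
  have L: "compact (L n)" "L n \<subseteq> A" for n
    unfolding L_def using K by (auto intro!: compact_UN)
  have L': "K n \<subseteq> L n" for n unfolding L_def by auto
  have incL: "incseq L" unfolding L_def by (intro monoI UN_mono) auto
  have Lb: "(\<Union>n. L n) \<in> sets borel" using L(1) by (auto intro: borel_compact)
  have LA: "(\<Union>n. L n) \<subseteq> A" using L by auto
  have "emeasure N A \<le> emeasure N (\<Union>n. L n)"
    unfolding f(2)
  proof (rule SUP_least)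
    show "f n \<le> emeasure N (\<Union>n. L n)" for n
      unfolding K(3) using L' Lb N by (intro emeasure_mono) auto
  qed
  then have "emeasure N A = emeasure N (\<Union>n. L n)"
    by (rule antisym) (use LA A(1) N in \<open>intro emeasure_mono, simp_all\<close>)
  then have "emeasure N (A - (\<Union>n. L n)) = 0"
    using LA Lb A N by (subst emeasure_Diff) auto
  then have "emeasure circle (A - (\<Union>n. L n)) = 0"
    using A Lb by (subst Ncircle) auto
  then have "AE z in circle. z \<notin> A - (\<Union>n. L n)"
    using A Lb by (intro AE_not_in null_setsI sets_circleI) auto
  with AE(2) have "AE z in circle. (\<lambda>n. indicator (L n) z :: ennreal) \<longlonglongrightarrow> indicator E z"
  proof eventually_elim
    case (elim z)
    show ?case
    proof (cases "z \<in> E")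
      case True
      with elim obtain m where "z \<in> L m" by auto
      then have "eventually (\<lambda>n. (indicator (L n) z :: ennreal) = indicator E z) sequentially"
        unfolding eventually_sequentially using incL True
        by (intro exI[of _ m]) (auto simp: indicator_def incseq_def)
      then show ?thesis by (rule tendsto_eventually)
    next
      case False
      then have "z \<notin> L n" for n using L(2)[of n] AE(1) by auto
      with False show ?thesis by simp
    qed
  qed
  moreover have "L n \<subseteq> E" for n using L(2)[of n] AE(1) by blast
  ultimately show ?thesis using L(1) incL that by blast
qed

text \<open>Every compact subset of \<open>E\<close> obeys the same bound, since its measure is no
  larger than that of \<open>E\<close>; (A3) carries the bound to \<open>E\<close> along an
  increasing sequence of such subsets.\<close>

lemma weak_type_small_sets:
  assumes bfn: "banach_function_norm \<rho>" and wt: "hilbert_weak_type_Linf \<rho>" and e: "0 < e"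
  obtains \<delta> where "0 < \<delta>" "\<And>E. E \<in> sets circle \<Longrightarrow> measure circle E < \<delta> \<Longrightarrow> \<rho> (indicator E) \<le> ennreal e"
proof -
  interpret prob_space circle by (rule prob_space_circle)
  obtain C where C: "0 < C" "\<And>l f. 0 < l \<Longrightarrow> f \<in> Linf \<Longrightarrow>
        X_norm \<rho> (indicator {\<zeta> \<in> sphere 0 1. l < cmod (hilbert_transform f \<zeta>)})
          \<le> ennreal C * Linf_norm f / ennreal l"
    using wt unfolding hilbert_weak_type_Linf_def by blast
  \<comment> \<open>Chosen to make the bound \<open>C * pi / l\<close> for compact sets equal to
    \<open>e\<close>.\<close>
  define l where "l = C * pi / e"
  have l: "0 < l" "C * pi / l = e" using C(1) e by (simp_all add: l_def)
  show ?thesis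
  proof
    show "0 < exp (- l) / 2" by simp
    fix E assume E: "E \<in> sets circle" "measure circle E < exp (- l) / 2"
    obtain L where L: "\<And>n::nat. compact (L n)" "\<And>n. L n \<subseteq> E" "incseq L"
        "AE z in circle. (\<lambda>n. indicator (L n) z :: ennreal) \<longlonglongrightarrow> indicator E z"
      using circle_inner_regular_sequence[OF E(1)] by blast
    have "E \<subseteq> sphere 0 1" using sets.sets_into_space[OF E(1)] by simp
    with L(2) have LS: "L n \<subseteq> sphere 0 1" for n by blast
    have Ls: "L n \<in> sets circle" for n
      using L(1) LS by (intro sets_circleI borel_compact)
    have bound: "\<rho> (indicator (L n)) \<le> ennreal e" for n
    proof (cases "L n = {}")
      case True
      have "\<rho> (indicator {}) = 0"
        using bfn unfolding banach_function_norm_def by (auto simp: indicator_def)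
      with True show ?thesis by simp
    next
      case False
      have "measure circle (L n) \<le> measure circle E"
        using L(2) E by (intro finite_measure_mono) auto
      then have "\<rho> (indicator (L n)) \<le> ennreal (C * pi / l)"
        using E(2) by (intro weak_type_compact_bound[OF bfn C L(1) LS False _ l(1)]) auto
      then show ?thesis by (simp add: l(2))
    qed
    have "AE z in circle. incseq (\<lambda>n. indicator (L n) z :: ennreal) \<and> (\<lambda>n. indicator (L n) z :: ennreal) \<longlonglongrightarrow> indicator E z"
      using L(4)
    proof eventually_elim
      case (elim z)
      have "incseq (\<lambda>n. indicator (L n) z :: ennreal)"
        using L(3) by (auto simp: incseq_def indicator_def)
      with elim show ?case by blast
    qed
    moreover have "\<forall>F f. (\<forall>n::nat. F n \<in> borel_measurable circle) \<and> f \<in> borel_measurable circle \<and>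
        (AE z in circle. incseq (\<lambda>n. F n z) \<and> (\<lambda>n. F n z) \<longlonglongrightarrow> f z) \<longrightarrow>
        incseq (\<lambda>n. \<rho> (F n)) \<and> (\<lambda>n. \<rho> (F n)) \<longlonglongrightarrow> \<rho> f"
      using bfn unfolding banach_function_norm_def by blast
    ultimately have "(\<lambda>n. \<rho> (indicator (L n))) \<longlonglongrightarrow> \<rho> (indicator E)"
      using Ls E(1) by (simp add: borel_measurable_indicator)
    then show "\<rho> (indicator E) \<le> ennreal e"
      by (rule LIMSEQ_le_const2) (use bound in blast)
  qed
qed

section \<open>The two inclusions between \<open>X_a\<close> and \<open>X_b\<close>\<close>

lemma banach_function_norm_mono:
  assumes "banach_function_norm \<rho>" "f \<in> borel_measurable circle" "g \<in> borel_measurable circle"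
    "AE z in circle. g z \<le> f z"
  shows "\<rho> g \<le> \<rho> f"
  using assms unfolding banach_function_norm_def by blast

lemma banach_function_norm_add:
  assumes "banach_function_norm \<rho>" "f \<in> borel_measurable circle" "g \<in> borel_measurable circle"
  shows "\<rho> (\<lambda>z. f z + g z) \<le> \<rho> f + \<rho> g"
proof -
  have "\<forall>f\<in>borel_measurable circle. \<forall>g\<in>borel_measurable circle. \<rho> (\<lambda>z. f z + g z) \<le> \<rho> f + \<rho> g"
    using assms(1) unfolding banach_function_norm_def by (elim conjE)
  from bspec[OF bspec[OF this assms(2)] assms(3)] show ?thesis .
qed

lemma banach_function_norm_scale:
  assumes "banach_function_norm \<rho>" "f \<in> borel_measurable circle" "0 \<le> c"
  shows "\<rho> (\<lambda>z. ennreal c * f z) = ennreal c * \<rho> f"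
proof -
  have "\<forall>f\<in>borel_measurable circle. \<forall>c::real. 0 \<le> c \<longrightarrow> \<rho> (\<lambda>z. ennreal c * f z) = ennreal c * \<rho> f"
    using assms(1) unfolding banach_function_norm_def by (elim conjE)
  from bspec[OF this assms(2)] assms(3) show ?thesis by blast
qed

text \<open>Both inclusions rest on a pointwise estimate of this shape, which (A1) and (A2) turn
  into an estimate of norms.\<close>

lemma banach_function_norm_le_scale_add:
  assumes bfn: "banach_function_norm \<rho>" and "f \<in> borel_measurable circle"
    and g: "g \<in> borel_measurable circle" and h: "h \<in> borel_measurable circle"
    and c: "0 \<le> c" and le: "\<And>z. z \<in> sphere 0 1 \<Longrightarrow> f z \<le> g z + ennreal c * h z"
  shows "\<rho> f \<le> \<rho> g + ennreal c * \<rho> h"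
proof -
  have [measurable]: "f \<in> borel_measurable circle" "g \<in> borel_measurable circle" "h \<in> borel_measurable circle"
    by fact+
  have "\<rho> f \<le> \<rho> (\<lambda>z. g z + ennreal c * h z)"
    using le by (intro banach_function_norm_mono[OF bfn] AE_I2) auto
  also have "\<dots> \<le> \<rho> g + \<rho> (\<lambda>z. ennreal c * h z)"
    using bfn by (rule banach_function_norm_add) measurable
  also have "\<rho> (\<lambda>z. ennreal c * h z) = ennreal c * \<rho> h"
    using bfn h c by (rule banach_function_norm_scale)
  finally show ?thesis .
qed

text \<open>Tolerances are of type \<open>ennreal\<close> and may be infinite; a smaller real one
  allows the estimates to be split by real arithmetic.\<close>

lemma ennreal_pos_real_below:
  fixes e :: ennreal
  assumes "0 < e"
  obtains r :: real where "0 < r" "ennreal r < e"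
proof -
  obtain x where "0 < x" "x < e" using dense[OF assms] by blast
  then have "ennreal (enn2real x) = x" "0 < enn2real x"
    by (auto simp: ennreal_enn2real_if enn2real_positive_iff less_top[symmetric])
  with \<open>x < e\<close> show ?thesis using that by metis
qed

text \<open>Absolute continuity of the norm of \<open>f\<close> replaces dominated convergence: the
  differences \<open>f - F n\<close> tend to 0 pointwise and are dominated by
  \<open>3 * \<bar>f\<bar>\<close>.\<close>

lemma X_a_subset_X_b:
  assumes bfn: "banach_function_norm \<rho>"
  shows "X_a \<rho> \<subseteq> X_b \<rho>"
proof
  fix f assume f: "f \<in> X_a \<rho>"
  then have fX: "f \<in> X_space \<rho>" and ac: "\<And>\<gamma>. (\<And>n::nat. \<gamma> n \<in> sets circle) \<Longrightarrow>
     (AE z in circle. (\<lambda>n. indicator (\<gamma> n) z :: real) \<longlonglongrightarrow> 0) \<Longrightarrow>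
     (\<lambda>n. X_norm \<rho> (\<lambda>z. f z * indicator (\<gamma> n) z)) \<longlonglongrightarrow> 0"
    unfolding X_a_def by blast+
  have [measurable]: "f \<in> borel_measurable circle" using fX by (simp add: X_space_def)
  have one: "sphere 0 1 \<in> sets circle" using sets.top[of circle] by simp
  obtain F where F: "\<And>i. simple_function circle (F i)"
    "\<And>z. z \<in> space circle \<Longrightarrow> (\<lambda>i. F i z) \<longlonglongrightarrow> f z"
    "\<And>i z. z \<in> space circle \<Longrightarrow> dist (F i z) 0 \<le> 2 * dist (f z) 0"
    using borel_measurable_implies_sequence_metric[OF \<open>f \<in> borel_measurable circle\<close>, of 0] by blast
  have [measurable]: "F i \<in> borel_measurable circle" for i
    using F(1) by (rule borel_measurable_simple_function)
  have "\<exists>s. simple_function circle s \<and> X_norm \<rho> (\<lambda>z. f z - s z) < \<epsilon>" if "0 < \<epsilon>" for \<epsilon>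
  proof -
    obtain r where r: "0 < r" "ennreal r < \<epsilon>" using \<open>0 < \<epsilon>\<close> by (rule ennreal_pos_real_below)
    obtain c where c: "0 \<le> c" "\<rho> (indicator (sphere 0 1)) = ennreal c"
    proof -
      have "\<rho> (indicator (sphere 0 1)) < \<infinity>"
        using bfn one unfolding banach_function_norm_def by blast
      with that show ?thesis by (cases "\<rho> (indicator (sphere 0 1))") auto
    qed
    \<comment> \<open>The constant \<open>c\<close> is the norm of 1, finite by (A4). The part of
      the error below \<open>\<eta>\<close> costs at most \<open>\<eta> * c\<close>, half of
      \<open>r\<close>; adding 1 keeps the denominator positive.\<close>
    define \<eta> where "\<eta> = r / (2 * (c + 1))"
    have \<eta>: "0 < \<eta>" "\<eta> * c \<le> r / 2" using r c by (auto simp: \<eta>_def field_simps)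
    define \<gamma> where "\<gamma> n = {z \<in> space circle. \<eta> < cmod (f z - F n z)}" for n
    have \<gamma>[measurable]: "\<gamma> n \<in> sets circle" for n unfolding \<gamma>_def by measurable
    have "(\<lambda>n. X_norm \<rho> (\<lambda>z. f z * indicator (\<gamma> n) z)) \<longlonglongrightarrow> 0"
    proof (rule ac[OF \<gamma> AE_I2])
      fix z assume z: "z \<in> space circle"
      have "(\<lambda>n. cmod (f z - F n z)) \<longlonglongrightarrow> cmod (f z - f z)"
        by (intro tendsto_intros F z)
      then have "eventually (\<lambda>n. cmod (f z - F n z) < \<eta>) sequentially"
        using \<eta>(1) by (intro order_tendstoD(2)) auto
      then have "eventually (\<lambda>n. (indicator (\<gamma> n) z :: real) = 0) sequentially"
        by eventually_elim (auto simp: \<gamma>_def)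
      then show "(\<lambda>n. indicator (\<gamma> n) z :: real) \<longlonglongrightarrow> 0" by (rule tendsto_eventually)
    qed
    \<comment> \<open>The factor 3 in the domination turns \<open>r / 6\<close> into the other half
      of \<open>r\<close>.\<close>
    then have "eventually (\<lambda>n. X_norm \<rho> (\<lambda>z. f z * indicator (\<gamma> n) z) < ennreal (r / 6)) sequentially"
      using r by (intro order_tendstoD(2)) auto
    then obtain n where n: "X_norm \<rho> (\<lambda>z. f z * indicator (\<gamma> n) z) < ennreal (r / 6)"
      by (auto simp: eventually_sequentially)
    have "\<rho> (\<lambda>z. ennreal \<eta> * indicator (sphere 0 1) z) = ennreal (\<eta> * c)"
      using one \<eta>(1) c by (subst banach_function_norm_scale[OF bfn]) (auto simp: ennreal_mult)
    moreover have "X_norm \<rho> (\<lambda>z. f z - F n z) \<le>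
        \<rho> (\<lambda>z. ennreal \<eta> * indicator (sphere 0 1) z) + ennreal 3 * X_norm \<rho> (\<lambda>z. f z * indicator (\<gamma> n) z)"
      unfolding X_norm_def
    proof (rule banach_function_norm_le_scale_add[OF bfn])
      fix z :: complex assume z: "z \<in> sphere 0 1"
      have "cmod (f z - F n z) \<le> \<eta> + 3 * cmod (f z * indicator (\<gamma> n) z)"
      proof (cases "z \<in> \<gamma> n")
        case True
        have "cmod (f z - F n z) \<le> cmod (f z) + cmod (F n z)" by (rule norm_triangle_ineq4)
        also have "cmod (F n z) \<le> 2 * cmod (f z)" using F(3)[of z n] z by simp
        finally show ?thesis using True \<eta>(1) by simp
      qed (use z in \<open>auto simp: \<gamma>_def\<close>)
      then have "ennreal (cmod (f z - F n z)) \<le> ennreal (\<eta> + 3 * cmod (f z * indicator (\<gamma> n) z))"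
        by (rule ennreal_leI)
      also have "\<dots> = ennreal \<eta> * indicator (sphere 0 1) z + ennreal 3 * ennreal (cmod (f z * indicator (\<gamma> n) z))"
        using z \<eta>(1) by (simp add: ennreal_plus ennreal_mult)
      finally show "ennreal (cmod (f z - F n z)) \<le> ennreal \<eta> * indicator (sphere 0 1) z + ennreal 3 * ennreal (cmod (f z * indicator (\<gamma> n) z))" .
    next
      have [measurable]: "sphere 0 1 \<in> sets circle" by (rule one)
      show "(\<lambda>z. ennreal \<eta> * indicator (sphere 0 1) z) \<in> borel_measurable circle" by measurable
      show "(\<lambda>z. ennreal (cmod (f z - F n z))) \<in> borel_measurable circle"
        "(\<lambda>z. ennreal (cmod (f z * indicator (\<gamma> n) z))) \<in> borel_measurable circle" by measurable
    qed simp
    ultimately have "X_norm \<rho> (\<lambda>z. f z - F n z) \<le> ennreal (\<eta> * c) + ennreal 3 * X_norm \<rho> (\<lambda>z. f z * indicator (\<gamma> n) z)"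
      by simp
    also have "\<dots> \<le> ennreal (\<eta> * c) + ennreal 3 * ennreal (r / 6)"
      by (intro add_left_mono mult_left_mono less_imp_le[OF n]) auto
    also have "ennreal 3 * ennreal (r / 6) = ennreal (r / 2)"
      using r by (subst ennreal_mult[symmetric]) auto
    also have "ennreal (\<eta> * c) + ennreal (r / 2) = ennreal (\<eta> * c + r / 2)"
      using \<eta>(1) c r by (subst ennreal_plus) auto
    also have "\<dots> \<le> ennreal r" using \<eta>(2) by (intro ennreal_leI) auto
    finally show ?thesis using F(1) r(2) by (blast intro: le_less_trans)
  qed
  then show "f \<in> X_b \<rho>" using fX by (simp add: X_b_def)
qed

text \<open>For a simple \<open>s\<close> close to \<open>f\<close> and bounded by \<open>M\<close>,
  the modulus of \<open>f\<close> times an indicator is at most \<open>\<bar>f - s\<bar>\<close>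
  plus \<open>M\<close> times that indicator. The first term is small in norm by the choice of
  \<open>s\<close>, the second by \<open>small\<close> once the set has small measure.\<close>

lemma X_b_subset_X_a:
  assumes bfn: "banach_function_norm \<rho>"
    and small: "\<And>e::real. 0 < e \<Longrightarrow> \<exists>\<delta>>0. \<forall>E\<in>sets circle. measure circle E < \<delta> \<longrightarrow> \<rho> (indicator E) \<le> ennreal e"
  shows "X_b \<rho> \<subseteq> X_a \<rho>"
proof
  interpret prob_space circle by (rule prob_space_circle)
  fix f assume f: "f \<in> X_b \<rho>"
  then have fX: "f \<in> X_space \<rho>" and approx: "\<And>\<epsilon>. 0 < \<epsilon> \<Longrightarrow> \<exists>s. simple_function circle s \<and> X_norm \<rho> (\<lambda>z. f z - s z) < \<epsilon>"
    unfolding X_b_def by blast+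
  have fm[measurable]: "f \<in> borel_measurable circle" using fX by (simp add: X_space_def)
  have "(\<lambda>n. X_norm \<rho> (\<lambda>z. f z * indicator (\<gamma> n) z)) \<longlonglongrightarrow> 0"
    if \<gamma>: "\<And>n::nat. \<gamma> n \<in> sets circle" and lim: "AE z in circle. (\<lambda>n. indicator (\<gamma> n) z :: real) \<longlonglongrightarrow> 0" for \<gamma>
  proof (rule order_tendstoI)
    fix a :: ennreal assume "0 < a"
    then obtain r where r: "0 < r" "ennreal r < a" by (rule ennreal_pos_real_below)
    obtain s where s: "simple_function circle s" "X_norm \<rho> (\<lambda>z. f z - s z) < ennreal (r / 2)"
      using approx[of "ennreal (r / 2)"] r by auto
    note [measurable] = borel_measurable_simple_function[OF s(1)] \<gamma>
    have "bounded (s ` space circle)"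
      using simple_functionD(1)[OF s(1)] by (rule finite_imp_bounded)
    then obtain M where M: "0 < M" "\<And>z. z \<in> space circle \<Longrightarrow> cmod (s z) \<le> M"
      unfolding bounded_pos by auto
    obtain \<delta> where \<delta>: "0 < \<delta>" "\<And>E. E \<in> sets circle \<Longrightarrow> measure circle E < \<delta> \<Longrightarrow> \<rho> (indicator E) \<le> ennreal (r / (2 * M))"
      using small[of "r / (2 * M)"] r M(1) by auto
    \<comment> \<open>Convergence of the indicators almost everywhere gives convergence of the
      measures to 0; the constant 1 is an integrable majorant on a probability space.\<close>
    have "(\<lambda>n. integral\<^sup>L circle (indicator (\<gamma> n) :: complex \<Rightarrow> real)) \<longlonglongrightarrow> integral\<^sup>L circle (\<lambda>_. 0 :: real)"
      by (rule integral_dominated_convergence[where w = "\<lambda>_. 1"]) (use lim in auto)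
    moreover have "integral\<^sup>L circle (indicator (\<gamma> n) :: complex \<Rightarrow> real) = measure circle (\<gamma> n)" for n
      using sets.sets_into_space[OF \<gamma>[of n]] by (simp add: Int_absorb2)
    ultimately have "(\<lambda>n. measure circle (\<gamma> n)) \<longlonglongrightarrow> 0" by simp
    then have "eventually (\<lambda>n. measure circle (\<gamma> n) < \<delta>) sequentially"
      using \<delta>(1) by (rule order_tendstoD)
    then show "eventually (\<lambda>n. X_norm \<rho> (\<lambda>z. f z * indicator (\<gamma> n) z) < a) sequentially"
    proof eventually_elim
      case (elim n)
      have "X_norm \<rho> (\<lambda>z. f z * indicator (\<gamma> n) z) \<le> X_norm \<rho> (\<lambda>z. f z - s z) + ennreal M * \<rho> (indicator (\<gamma> n))"
        unfolding X_norm_def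
      proof (rule banach_function_norm_le_scale_add[OF bfn])
        fix z :: complex assume z: "z \<in> sphere 0 1"
        have "cmod (f z * indicator (\<gamma> n) z) \<le> cmod (f z - s z) + M * indicator (\<gamma> n) z"
        proof (cases "z \<in> \<gamma> n")
          case True
          have "cmod (f z) \<le> cmod (f z - s z) + cmod (s z)"
            using norm_triangle_ineq[of "f z - s z" "s z"] by simp
          then show ?thesis using True M(2)[of z] z by simp
        qed simp
        then have "ennreal (cmod (f z * indicator (\<gamma> n) z)) \<le> ennreal (cmod (f z - s z) + M * indicator (\<gamma> n) z)"
          by (rule ennreal_leI)
        also have "\<dots> = ennreal (cmod (f z - s z)) + ennreal M * indicator (\<gamma> n) z"
          using M(1) by (auto simp: indicator_def ennreal_plus)
        finally show "ennreal (cmod (f z * indicator (\<gamma> n) z)) \<le> ennreal (cmod (f z - s z)) + ennreal M * indicator (\<gamma> n) z" .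
      next
        show "(\<lambda>z. ennreal (cmod (f z * indicator (\<gamma> n) z))) \<in> borel_measurable circle"
          "(\<lambda>z. ennreal (cmod (f z - s z))) \<in> borel_measurable circle"
          "indicator (\<gamma> n) \<in> borel_measurable circle" by measurable
      qed (use M(1) in simp)
      also have "\<dots> \<le> ennreal (r / 2) + ennreal M * ennreal (r / (2 * M))"
        by (intro add_mono mult_left_mono less_imp_le[OF s(2)] \<delta>(2)[OF \<gamma> elim]) auto
      also have "\<dots> = ennreal r"
        using r M(1) by (simp add: ennreal_mult[symmetric] ennreal_plus[symmetric] del: ennreal_plus)
      finally show ?case using r(2) by (rule le_less_trans)
    qed
  qed simp
  then show "f \<in> X_a \<rho>" using fX by (auto simp: X_a_def)
qed

theorem theorem3p4:
  fixes \<rho> :: "(complex \<Rightarrow> ennreal) \<Rightarrow> ennreal"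
  assumes "banach_function_norm \<rho>"
    and "hilbert_weak_type_Linf \<rho>"
  shows "X_a \<rho> = X_b \<rho>"
proof (rule antisym)
  show "X_b \<rho> \<subseteq> X_a \<rho>"
  proof (rule X_b_subset_X_a[OF assms(1)])
    fix e :: real assume "0 < e"
    then obtain \<delta> where "0 < \<delta>"
      "\<And>E. E \<in> sets circle \<Longrightarrow> measure circle E < \<delta> \<Longrightarrow> \<rho> (indicator E) \<le> ennreal e"
      using weak_type_small_sets[OF assms] by metis
    then show "\<exists>\<delta>>0. \<forall>E\<in>sets circle. measure circle E < \<delta> \<longrightarrow> \<rho> (indicator E) \<le> ennreal e"
      by blast
  qed
qed (rule X_a_subset_X_b[OF assms(1)])

end
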